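(* Let $R$ be a (not necessarily commutative) ring, $R_0\subseteq R$ a subring, and let $\psi(z)=\sum_{n=0}^{\infty}a_nz^n$ be an $R$-valued function of the complex variable $z$, analytic at $z=0$, with coefficients $a_n\in R$ ($n\ge 0$), and put $a_n=0$ for $n<0$. Let $$L=\sum_{i=\mu}^{\nu}\sum_{j=0}^{\kappa}c_{ij}\,z^i\partial_z^j\in R_0[z,z^{-1},\partial_z],\qquad \mu<\nu\in\mathbb{Z},\ \kappa\in\mathbb{N}\cup\{0\},\ c_{ij}\in R_0,$$ and let $\Omega_L$ be the associated difference operator $$\Omega_L=\sum_{i=\mu}^{\nu}\sum_{j=0}^{\kappa}c_{ij}\prod_{k=0}^{j-1}(n+j-i-k)\,\mathfrak{S}^{j-i}.$$ Let $\lambda\in R$. If $\psi(z)$ is an eigenfunction for $L$ with left eigenvalue $\lambda$, i.e. $L(\psi(z))=\lambda\psi(z)$ (respectively with right eigenvalue $\lambda$, i.e. $L(\psi(z))=\psi(z)\lambda$), then the sequence $\{a_0,a_1,a_2,\ldots\}$ is an eigensequence for $\Omega_L$ with left eigenvalue $\lambda$, i.e. $\Omega_L(a)_n=\lambda a_n$ for every integer $n\ge 0$ (respectively with right eigenvalue $\lambda$, i.e. $\Omega_L(a)_n=a_n\lambda$ for every integer $n\ge 0$).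
   Context: No commutativity of $R$ is assumed, but the variable $z$ commutes with all elements of $R$. The ring $R$ is assumed to carry a suitable topology so that the power series for $\psi$ converges near $z=0$ and analyticity makes sense; the topology plays no other role. The coefficients satisfy $\psi^{(n)}(0)=n!\,a_n$ for $n\ge 0$, and $a_n=0$ for $n<0$ by convention. The monomial differential operator $z^i\partial_z^j$ ($i\in\mathbb{Z}$, $j\in\mathbb{N}\cup\{0\}$) acts on sufficiently differentiable $R$-valued functions by $z^i\partial_z^j(\gamma(z))=z^i\gamma^{(j)}(z)$. $R_0[z,z^{-1},\partial_z]$ is the ring of all finite linear combinations of such monomials with coefficients in $R_0$ (written on the left), acting by linear extension. For $f:\mathbb{N}\cup\{0\}\to R_0$ and $i\in\mathbb{Z}$, the elementary difference operator $f\mathfrak{S}^i$ turns the sequence $\{a_n\}$ into a new sequence by $f\mathfrak{S}^i(a)_n=f(n)\,a_{n+i}$ (which is zero if $n+i<0$). A difference operator is a finite sum of these, acting by linear extension. Thus, explicitly, $\Omega_L(a)_n=\sum_{i=\mu}^{\nu}\sum_{j=0}^{\kappa}c_{ij}(n+j-i)(n+j-i-1)\cdots(n-i+1)\,a_{n+j-i}$, where the empty product (for $j=0$) is $1$. *)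

theory Defs
  imports Complex_Main
begin

section \<open>The coefficient ring\<close>

definition is_seminorm :: "(complex \<Rightarrow> 'a::ring \<Rightarrow> 'a) \<Rightarrow> ('a \<Rightarrow> real) \<Rightarrow> bool" where
  "is_seminorm scale p \<longleftrightarrow>
     (\<forall>x y. p (x + y) \<le> p x + p y) \<and> (\<forall>z x. p (scale z x) = norm z * p x)"

text \<open>
  The ring \<open>R\<close> is the whole type; it need be neither commutative nor unital. A complex variable
  \<open>z\<close> that commutes with every element of \<open>R\<close> acts through the bilinear scalar multiplication
  \<open>scale\<close>; for unital \<open>R\<close> this is multiplication by a central copy of the complex numbers.
  The topology is Hausdorff (by the class) and locally convex, which covers Banach and Frechet
  algebras. Neither completeness nor joint continuity of the product is required.
\<close>

locale locally_convex_algebra = vector_space scale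
  for scale :: "complex \<Rightarrow> 'a::{ring, topological_ab_group_add, t2_space} \<Rightarrow> 'a" +
  assumes scale_mult_left: "scale z x * y = scale z (x * y)"
    and scale_mult_right: "x * scale z y = scale z (x * y)"
    and continuous_scale: "continuous_on UNIV (\<lambda>(z, x). scale z x)"
    and continuous_mult_left: "continuous_on UNIV (\<lambda>x::'a. a * x)"
    and continuous_mult_right: "continuous_on UNIV (\<lambda>x::'a. x * a)"
    and locally_convex: "open U \<Longrightarrow> 0 \<in> U \<Longrightarrow>
      \<exists>p. is_seminorm scale p \<and> continuous_on UNIV p \<and> {x. p x < 1} \<subseteq> U"

definition is_subring :: "'a::ring set \<Rightarrow> bool" where
  "is_subring S \<longleftrightarrow> 0 \<in> S \<and> (\<forall>x\<in>S. \<forall>y\<in>S. x - y \<in> S \<and> x * y \<in> S)"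

section \<open>Functions of a complex variable and differential operators\<close>

definition analytic_at_0_with_coeffs ::
  "(complex \<Rightarrow> 'a::{ring, topological_space} \<Rightarrow> 'a) \<Rightarrow> (complex \<Rightarrow> 'a) \<Rightarrow> (nat \<Rightarrow> 'a) \<Rightarrow> bool" where
  "analytic_at_0_with_coeffs scale \<psi> a \<longleftrightarrow>
     (\<exists>r>0. \<forall>z. norm z < r \<longrightarrow> (\<lambda>n. scale (z ^ n) (a n)) sums \<psi> z)"

definition has_cderiv ::
  "(complex \<Rightarrow> 'a::{ring, topological_space} \<Rightarrow> 'a) \<Rightarrow> (complex \<Rightarrow> 'a) \<Rightarrow> 'a \<Rightarrow> complex \<Rightarrow> bool" where
  "has_cderiv scale f D z \<longleftrightarrow>
     ((\<lambda>h. scale (inverse h) (f (z + h) - f z)) \<longlongrightarrow> D) (at 0)"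

definition cderiv ::
  "(complex \<Rightarrow> 'a::{ring, topological_space} \<Rightarrow> 'a) \<Rightarrow> (complex \<Rightarrow> 'a) \<Rightarrow> complex \<Rightarrow> 'a" where
  "cderiv scale f z = (THE D. has_cderiv scale f D z)"

definition higher_cderiv ::
  "(complex \<Rightarrow> 'a::{ring, topological_space} \<Rightarrow> 'a) \<Rightarrow> nat \<Rightarrow> (complex \<Rightarrow> 'a) \<Rightarrow> complex \<Rightarrow> 'a" where
  "higher_cderiv scale j f = (cderiv scale ^^ j) f"

definition monomial_op ::
  "(complex \<Rightarrow> 'a::{ring, topological_space} \<Rightarrow> 'a) \<Rightarrow> int \<Rightarrow> nat \<Rightarrow> (complex \<Rightarrow> 'a) \<Rightarrow> complex \<Rightarrow> 'a" where
  "monomial_op scale i j \<gamma> z = scale (z powi i) (higher_cderiv scale j \<gamma> z)"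

definition differential_op ::
  "(complex \<Rightarrow> 'a::{ring, topological_space} \<Rightarrow> 'a) \<Rightarrow> (int \<Rightarrow> nat \<Rightarrow> 'a) \<Rightarrow> int \<Rightarrow> int \<Rightarrow> nat
     \<Rightarrow> (complex \<Rightarrow> 'a) \<Rightarrow> complex \<Rightarrow> 'a" where
  "differential_op scale c \<mu> \<nu> \<kappa> \<gamma> z =
     (\<Sum>i\<in>{\<mu>..\<nu>}. \<Sum>j\<in>{0..\<kappa>}. c i j * monomial_op scale i j \<gamma> z)"

text \<open>
  The eigenvalue equation is an identity of functions near \<open>0\<close>. The point \<open>z = 0\<close> itself is left
  out, because negative powers of \<open>z\<close> may occur. The first conjunct below says that \<open>\<psi>\<close> belongs to
  the domain of an operator of order \<open>\<kappa>\<close>, so that no derivative in the equation is a junk value of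
  \<open>cderiv\<close>. For analytic \<open>\<psi>\<close> it is automatic when the ring is sequentially complete.
\<close>

definition differentiable_up_to ::
  "(complex \<Rightarrow> 'a::{ring, topological_space} \<Rightarrow> 'a) \<Rightarrow> nat \<Rightarrow> (complex \<Rightarrow> 'a) \<Rightarrow> complex \<Rightarrow> bool" where
  "differentiable_up_to scale \<kappa> f z \<longleftrightarrow>
     (\<forall>j<\<kappa>. \<exists>D. has_cderiv scale (higher_cderiv scale j f) D z)"

definition left_eigenfunction ::
  "(complex \<Rightarrow> 'a::{ring, topological_space} \<Rightarrow> 'a) \<Rightarrow> (int \<Rightarrow> nat \<Rightarrow> 'a) \<Rightarrow> int \<Rightarrow> int \<Rightarrow> nat
     \<Rightarrow> (complex \<Rightarrow> 'a) \<Rightarrow> 'a \<Rightarrow> bool" where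
  "left_eigenfunction scale c \<mu> \<nu> \<kappa> \<psi> lam \<longleftrightarrow>
     (\<forall>\<^sub>F z in at 0. differentiable_up_to scale \<kappa> \<psi> z) \<and>
     (\<forall>\<^sub>F z in at 0. differential_op scale c \<mu> \<nu> \<kappa> \<psi> z = lam * \<psi> z)"

definition right_eigenfunction ::
  "(complex \<Rightarrow> 'a::{ring, topological_space} \<Rightarrow> 'a) \<Rightarrow> (int \<Rightarrow> nat \<Rightarrow> 'a) \<Rightarrow> int \<Rightarrow> int \<Rightarrow> nat
     \<Rightarrow> (complex \<Rightarrow> 'a) \<Rightarrow> 'a \<Rightarrow> bool" where
  "right_eigenfunction scale c \<mu> \<nu> \<kappa> \<psi> lam \<longleftrightarrow>
     (\<forall>\<^sub>F z in at 0. differentiable_up_to scale \<kappa> \<psi> z) \<and>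
     (\<forall>\<^sub>F z in at 0. differential_op scale c \<mu> \<nu> \<kappa> \<psi> z = \<psi> z * lam)"

section \<open>Sequences and difference operators\<close>

definition extend_by_0 :: "(nat \<Rightarrow> 'a::ring) \<Rightarrow> int \<Rightarrow> 'a" where
  "extend_by_0 a m = (if m < 0 then 0 else a (nat m))"

definition elementary_difference_op ::
  "(nat \<Rightarrow> 'a::ring) \<Rightarrow> int \<Rightarrow> (nat \<Rightarrow> 'a) \<Rightarrow> nat \<Rightarrow> 'a" where
  "elementary_difference_op f i a n = f n * extend_by_0 a (int n + i)"

text \<open>
  The integer factor is applied through \<open>scale\<close> because \<open>R\<close> need not contain a unit; the resulting
  coefficient is an integer multiple of \<open>c i j\<close>.
\<close>

definition difference_op ::
  "(complex \<Rightarrow> 'a::ring \<Rightarrow> 'a) \<Rightarrow> (int \<Rightarrow> nat \<Rightarrow> 'a) \<Rightarrow> int \<Rightarrow> int \<Rightarrow> nat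
     \<Rightarrow> (nat \<Rightarrow> 'a) \<Rightarrow> nat \<Rightarrow> 'a" where
  "difference_op scale c \<mu> \<nu> \<kappa> a n =
     (\<Sum>i\<in>{\<mu>..\<nu>}. \<Sum>j\<in>{0..\<kappa>}.
        elementary_difference_op
          (\<lambda>n. scale (of_int (\<Prod>k\<in>{0..<j}. int n + int j - i - int k)) (c i j))
          (int j - i) a n)"

definition left_eigensequence ::
  "((nat \<Rightarrow> 'a::ring) \<Rightarrow> nat \<Rightarrow> 'a) \<Rightarrow> (nat \<Rightarrow> 'a) \<Rightarrow> 'a \<Rightarrow> bool" where
  "left_eigensequence \<Omega> a lam \<longleftrightarrow> (\<forall>n. \<Omega> a n = lam * a n)"

definition right_eigensequence ::
  "((nat \<Rightarrow> 'a::ring) \<Rightarrow> nat \<Rightarrow> 'a) \<Rightarrow> (nat \<Rightarrow> 'a) \<Rightarrow> 'a \<Rightarrow> bool" where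
  "right_eigensequence \<Omega> a lam \<longleftrightarrow> (\<forall>n. \<Omega> a n = a n * lam)"

end

theory Submission
  imports Defs
begin

text \<open>
  Differentiating \<open>\<psi>\<close> termwise \<open>j\<close> times and multiplying by \<open>z\<^sup>i\<close> turns the coefficient sequence \<open>a\<close>
  into \<open>n \<mapsto> (n + j - i)(n + j - i - 1)\<cdots>(n - i + 1) a(n + j - i)\<close>. So \<open>L \<psi>\<close> is a Laurent series whose
  coefficients are \<open>\<Omega>\<^sub>L(a)\<close>, while \<open>\<lambda> \<psi>\<close> and \<open>\<psi> \<lambda>\<close> have the coefficients \<open>\<lambda> a(n)\<close> and \<open>a(n) \<lambda>\<close>; the
  theorem is a comparison of coefficients.

  Both analytic facts behind this, termwise differentiation (\<open>has_cderiv_power_series\<close>) and uniqueness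
  of coefficients (\<open>power_series_coeffs_unique\<close>), have to hold in a locally convex algebra that may be
  incomplete. Continuous seminorms \<open>p\<close> reduce them to real power series: terms of a convergent series
  tend to \<open>0\<close>, so the real series \<open>\<Sum> p(a(n)) x\<^sup>n\<close> converges on the same disc, and its tails bound the
  tails of the \<open>R\<close>-valued series (\<open>seminorm_tail_le\<close>). Absolute convergence in each \<open>p\<close> would not by
  itself produce a limit in \<open>R\<close>, but every limit is given: the sums by analyticity, the
  derivatives by the domain condition in the definition of an eigenfunction. It remains to show that
  the expected series converge to these given limits, and for this it suffices to test with each \<open>p\<close>.

  Nothing is known about the eigenvalue equation, or about the derivatives, at \<open>z = 0\<close>, so all series
  are considered on a punctured disc. Negative powers of \<open>z\<close> are removed by multiplying the equation
  with a large power \<open>z\<^sup>M\<close>; on coefficients this is the shift of \<open>sums_shift\<close>.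
\<close>

section \<open>Falling products and difference quotients of powers\<close>

definition falling_product :: "int \<Rightarrow> nat \<Rightarrow> int" where
  "falling_product m j = (\<Prod>k\<in>{0..<j}. m - int k)"

lemma falling_product_Suc: "falling_product m (Suc j) = falling_product m j * (m - int j)"
  by (simp add: falling_product_def)

lemma falling_product_eq_0:
  assumes "0 \<le> m" "m < int j"
  shows "falling_product m j = 0"
proof -
  have "nat m \<in> {0..<j}" "m - int (nat m) = 0" using assms by auto
  then show ?thesis unfolding falling_product_def by (meson finite_atLeastLessThan prod_zero)
qed

text \<open>
  A bound on the difference quotients of \<open>z\<^sup>n\<close> that is uniform in \<open>h\<close>. It makes the limit \<open>h \<rightarrow> 0\<close> and
  the sum over \<open>n\<close> interchangeable in termwise differentiation.
\<close>

lemma norm_power_difference_quotient_le: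
  fixes z h :: complex
  assumes "h \<noteq> 0" "norm z \<le> \<rho>" "norm (z + h) \<le> \<rho>"
  shows "norm (inverse h * ((z + h) ^ n - z ^ n)) \<le> real n * \<rho> ^ (n - 1)"
proof -
  have "inverse h * ((z + h) ^ n - z ^ n) = (\<Sum>i<n. z ^ (n - Suc i) * (z + h) ^ i)"
    using assms(1) power_diff_sumr2[of "z + h" n z] by simp
  also have "norm \<dots> \<le> (\<Sum>i<n. \<rho> ^ (n - 1))"
  proof (rule sum_norm_le)
    fix i assume "i \<in> {..<n}"
    then have "\<rho> ^ (n - 1) = \<rho> ^ (n - Suc i) * \<rho> ^ i"
      by (simp flip: power_add)
    moreover have "norm (z ^ (n - Suc i) * (z + h) ^ i) \<le> \<rho> ^ (n - Suc i) * \<rho> ^ i"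
      unfolding norm_mult norm_power
      using assms order_trans[OF norm_ge_zero assms(2)] by (intro mult_mono power_mono) auto
    ultimately show "norm (z ^ (n - Suc i) * (z + h) ^ i) \<le> \<rho> ^ (n - 1)" by simp
  qed
  finally show ?thesis by simp
qed

lemma tendsto_power_difference_quotient:
  fixes z :: complex
  shows "((\<lambda>h. inverse h * ((z + h) ^ n - z ^ n)) \<longlongrightarrow> of_nat n * z ^ (n - 1)) (at 0)"
proof -
  have "((\<lambda>x. x ^ n) has_field_derivative of_nat n * z ^ (n - 1)) (at z)"
    by (auto intro!: derivative_eq_intros)
  then show ?thesis by (simp add: DERIV_def divide_inverse mult.commute)
qed

section \<open>Continuous seminorms on a locally convex algebra\<close>

definition continuous_seminorm ::
  "(complex \<Rightarrow> 'a::{ring, topological_space} \<Rightarrow> 'a) \<Rightarrow> ('a \<Rightarrow> real) \<Rightarrow> bool" where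
  "continuous_seminorm scale p \<longleftrightarrow> is_seminorm scale p \<and> continuous_on UNIV p"

context locally_convex_algebra
begin

lemma
  assumes "continuous_seminorm scale p"
  shows seminorm_add_le: "p (x + y) \<le> p x + p y"
    and seminorm_scale: "p (scale w x) = norm w * p x"
    and seminorm_tendsto: "(f \<longlongrightarrow> l) F \<Longrightarrow> ((\<lambda>t. p (f t)) \<longlongrightarrow> p l) F"
proof -
  show "p (x + y) \<le> p x + p y" "p (scale w x) = norm w * p x"
    using assms by (auto simp: continuous_seminorm_def is_seminorm_def)
  show "((\<lambda>t. p (f t)) \<longlongrightarrow> p l) F" if "(f \<longlongrightarrow> l) F"
    using continuous_on_tendsto_compose[OF _ that, of UNIV p] assms
    by (auto simp: continuous_seminorm_def)
qed

lemma
  assumes "continuous_seminorm scale p"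
  shows seminorm_0: "p 0 = 0"
    and seminorm_minus: "p (- x) = p x"
    and seminorm_nonneg: "0 \<le> p x"
proof -
  show *: "p 0 = 0" using seminorm_scale[OF assms, of 0 0] by simp
  show **: "p (- x) = p x" for x using seminorm_scale[OF assms, of "-1" x] by simp
  show "0 \<le> p x" using seminorm_add_le[OF assms, of x "- x"] * **[of x] by simp
qed

lemma seminorm_sum_le:
  assumes "continuous_seminorm scale p"
  shows "p (sum f A) \<le> (\<Sum>x\<in>A. p (f x))"
proof (induct A rule: infinite_finite_induct)
  case (insert x A)
  then show ?case using seminorm_add_le[OF assms, of "f x" "sum f A"] by simp
qed (simp_all add: seminorm_0[OF assms])

text \<open>
  Local convexity is assumed at \<open>0\<close> only; translations carry it to every point.
\<close>

lemma neighbourhood_contains_seminorm_ball: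
  assumes "open U" "l \<in> U"
  obtains p where "continuous_seminorm scale p" "\<And>x. p (x - l) < 1 \<Longrightarrow> x \<in> U"
proof -
  have "open ((\<lambda>y. l + y) -` U)"
    using assms(1) by (intro open_vimage) (auto intro!: continuous_intros)
  then obtain p where p: "is_seminorm scale p" "continuous_on UNIV p"
      "{x. p x < 1} \<subseteq> (\<lambda>y. l + y) -` U"
    using locally_convex assms(2) by (metis add_0_right vimage_eq)
  have "x \<in> U" if "p (x - l) < 1" for x
    using p(3) that by force
  with p that show thesis by (auto simp: continuous_seminorm_def)
qed

lemma tendsto_if_seminorms_tendsto_0:
  assumes "\<And>p. continuous_seminorm scale p \<Longrightarrow> ((\<lambda>t. p (f t - l)) \<longlongrightarrow> 0) F"
  shows "(f \<longlongrightarrow> l) F"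
proof (rule topological_tendstoI)
  fix U :: "'a set" assume "open U" "l \<in> U"
  then obtain p where p: "continuous_seminorm scale p" "\<And>x. p (x - l) < 1 \<Longrightarrow> x \<in> U"
    using neighbourhood_contains_seminorm_ball by metis
  have "\<forall>\<^sub>F t in F. p (f t - l) < 1"
    using order_tendstoD(2)[OF assms[OF p(1)], of 1] by simp
  then show "\<forall>\<^sub>F t in F. f t \<in> U" by eventually_elim (rule p(2))
qed

lemma eq_0_if_seminorms_eq_0:
  assumes "\<And>p. continuous_seminorm scale p \<Longrightarrow> p x = 0"
  shows "x = 0"
proof -
  have "((\<lambda>n::nat. x) \<longlongrightarrow> 0) sequentially"
    by (rule tendsto_if_seminorms_tendsto_0) (simp add: assms)
  then show ?thesis by (simp add: LIMSEQ_const_iff)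
qed

text \<open>
  The Weierstrass majorant bound, for a series whose sum \<open>S\<close> is given rather than constructed from
  the majorant.
\<close>

lemma seminorm_tail_le:
  assumes p: "continuous_seminorm scale p" and x: "x sums S"
    and le: "\<And>n. p (x n) \<le> g n" and g: "summable g"
  shows "p (S - (\<Sum>n<N. x n)) \<le> suminf g - (\<Sum>n<N. g n)"
proof (rule LIMSEQ_le_const2)
  show "(\<lambda>M. p ((\<Sum>n<M. x n) - (\<Sum>n<N. x n))) \<longlonglongrightarrow> p (S - (\<Sum>n<N. x n))"
    using x by (intro seminorm_tendsto[OF p] tendsto_diff tendsto_const) (simp add: sums_def)
  have "p ((\<Sum>n<M. x n) - (\<Sum>n<N. x n)) \<le> suminf g - (\<Sum>n<N. g n)" if "N \<le> M" for M
  proof -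
    have "(\<Sum>n<M. x n) - (\<Sum>n<N. x n) = (\<Sum>n=N..<M. x n)"
      using sum_diff_nat_ivl[of 0 N M x] that by (simp add: atLeast0LessThan)
    then have "p ((\<Sum>n<M. x n) - (\<Sum>n<N. x n)) \<le> (\<Sum>n=N..<M. p (x n))"
      by (simp add: seminorm_sum_le[OF p])
    also have "\<dots> \<le> (\<Sum>n=N..<M. g n)" by (intro sum_mono le)
    also have "\<dots> = (\<Sum>n<M. g n) - (\<Sum>n<N. g n)"
      using sum_diff_nat_ivl[of 0 N M g] that by (simp add: atLeast0LessThan)
    also have "(\<Sum>n<M. g n) \<le> suminf g"
      using g le seminorm_nonneg[OF p] by (intro sum_le_suminf) (auto intro: order_trans)
    finally show ?thesis by simp
  qed
  then show "\<exists>M0. \<forall>M\<ge>M0. p ((\<Sum>n<M. x n) - (\<Sum>n<N. x n)) \<le> suminf g - (\<Sum>n<N. g n)"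
    by blast
qed

section \<open>Convergent series\<close>

lemma tendsto_scale:
  assumes "(f \<longlongrightarrow> w) F" "(g \<longlongrightarrow> x) F"
  shows "((\<lambda>t. scale (f t) (g t)) \<longlongrightarrow> scale w x) F"
  using continuous_on_tendsto_compose[OF continuous_scale tendsto_Pair[OF assms]] by simp

lemma sums_scale: "f sums x \<Longrightarrow> (\<lambda>n. scale w (f n)) sums scale w x"
  unfolding sums_def by (simp add: tendsto_scale flip: scale_sum_right)

lemma sums_mult_left: "f sums (x :: 'a) \<Longrightarrow> (\<lambda>n. y * f n) sums (y * x)"
  using continuous_on_tendsto_compose[OF continuous_mult_left[of y], of "\<lambda>n. \<Sum>i<n. f i" x sequentially]
  unfolding sums_def sum_distrib_left by simp

lemma sums_mult_right: "f sums (x :: 'a) \<Longrightarrow> (\<lambda>n. f n * y) sums (x * y)"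
  using continuous_on_tendsto_compose[OF continuous_mult_right[of y], of "\<lambda>n. \<Sum>i<n. f i" x sequentially]
  unfolding sums_def sum_distrib_right by simp

text \<open>
  Abel's lemma for seminorms: for \<open>\<bar>x\<bar> < K < r\<close> the terms at the point \<open>K\<close> tend to \<open>0\<close>, so \<open>p(b(n)) K\<^sup>n\<close>
  is bounded and a geometric series with ratio \<open>\<bar>x\<bar> / K\<close> dominates. The radius does not depend on \<open>p\<close>.
\<close>

lemma summable_seminorm_power_series:
  fixes x :: real
  assumes p: "continuous_seminorm scale p"
    and f: "\<And>z. 0 < norm z \<Longrightarrow> norm z < r \<Longrightarrow> (\<lambda>n. scale (z ^ n) (b n)) sums f z"
    and x: "norm x < r"
  shows "summable (\<lambda>n. p (b n) * x ^ n)"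
proof -
  obtain K where K: "norm x < K" "K < r" using x dense by blast
  then have "K > 0" by (smt (verit) norm_ge_zero)
  have S: "(\<lambda>N. \<Sum>n<N. scale (of_real K ^ n) (b n)) \<longlonglongrightarrow> f (of_real K)"
    using f[of "of_real K"] K \<open>K > 0\<close> by (simp add: sums_def)
  have "(\<lambda>N. scale (of_real K ^ N) (b N)) \<longlonglongrightarrow> 0"
    using tendsto_diff[OF LIMSEQ_Suc[OF S] S] by simp
  then have "(\<lambda>N. p (scale (of_real K ^ N) (b N))) \<longlonglongrightarrow> p 0"
    by (rule seminorm_tendsto[OF p])
  then have "(\<lambda>N. p (b N) * K ^ N) \<longlonglongrightarrow> 0"
    using \<open>K > 0\<close> by (simp add: seminorm_0[OF p] seminorm_scale[OF p] norm_power mult.commute)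
  from convergent_imp_Bseq[OF convergentI[OF this]] obtain C where C: "\<And>n. norm (p (b n) * K ^ n) \<le> C"
    unfolding Bseq_def by blast
  show ?thesis
  proof (rule summable_comparison_test')
    show "summable (\<lambda>n. C * (norm x / K) ^ n)"
      using K \<open>K > 0\<close> by (intro summable_mult summable_geometric) simp
    fix n :: nat
    have "norm (p (b n) * x ^ n) = norm (p (b n) * K ^ n) * (norm x / K) ^ n"
      using \<open>K > 0\<close> by (simp add: norm_mult norm_power abs_mult power_abs power_divide)
    also have "\<dots> \<le> C * (norm x / K) ^ n"
      using \<open>K > 0\<close> by (intro mult_right_mono C) auto
    finally show "norm (p (b n) * x ^ n) \<le> C * (norm x / K) ^ n" .
  qed
qed

section \<open>Uniqueness of coefficients\<close>

text \<open>
  For \<open>x > 0\<close>, the equation \<open>b(0) = - \<Sum> b(n) x\<^sup>n\<close> (sum over \<open>n \<ge> 1\<close>) gives \<open>p(b(0)) \<le> G(x) - G(0)\<close> with the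
  real power series \<open>G(x) = \<Sum> p(b(n)) x\<^sup>n\<close>, which is continuous at \<open>0\<close>.
\<close>

lemma power_series_zero_coeff_0:
  assumes r: "r > 0"
    and b: "\<And>z. 0 < norm z \<Longrightarrow> norm z < r \<Longrightarrow> (\<lambda>n. scale (z ^ n) (b n)) sums 0"
  shows "b 0 = 0"
proof (rule eq_0_if_seminorms_eq_0)
  fix p assume p: "continuous_seminorm scale p"
  define G where "G = (\<lambda>x::real. \<Sum>n. p (b n) * x ^ n)"
  have summable: "summable (\<lambda>n. p (b n) * x ^ n)" if "norm x < r" for x
    using summable_seminorm_power_series[OF p b that] .
  have "isCont G 0"
    unfolding G_def using r by (intro isCont_powser[of _ "r / 2"] summable) auto
  then have "(G \<longlongrightarrow> G 0) (at_right 0)"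
    by (auto simp: isCont_def intro: tendsto_mono[OF at_le])
  moreover have "G 0 = p (b 0)" by (simp add: G_def)
  ultimately have lim: "((\<lambda>x. G x - p (b 0)) \<longlongrightarrow> 0) (at_right 0)"
    using tendsto_diff[OF _ tendsto_const, of G "p (b 0)" "at_right 0" "p (b 0)"] by simp
  have "\<forall>\<^sub>F x in at_right 0. p (b 0) \<le> G x - p (b 0)"
  proof (rule eventually_at_rightI[of 0 r])
    fix x :: real assume "x \<in> {0<..<r}"
    then have "p (0 - (\<Sum>n<1. scale (of_real x ^ n) (b n)))
        \<le> (\<Sum>n. p (b n) * x ^ n) - (\<Sum>n<1. p (b n) * x ^ n)"
      by (intro seminorm_tail_le[OF p b] summable)
        (auto simp: seminorm_scale[OF p] norm_power mult.commute)
    then show "p (b 0) \<le> G x - p (b 0)"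
      by (simp add: G_def seminorm_minus[OF p])
  qed (use r in auto)
  then have "p (b 0) \<le> 0"
    by (intro tendsto_lowerbound[OF lim]) auto
  then show "p (b 0) = 0" using seminorm_nonneg[OF p, of "b 0"] by simp
qed

text \<open>
  Once \<open>b(0) = 0\<close>, division by \<open>z\<close>, possible on the punctured disc, gives another zero series, with the
  coefficients shifted by one.
\<close>

lemma power_series_zero_coeffs:
  assumes r: "r > 0"
    and b: "\<And>z. 0 < norm z \<Longrightarrow> norm z < r \<Longrightarrow> (\<lambda>n. scale (z ^ n) (b n)) sums 0"
  shows "b n = 0"
  using b
proof (induction n arbitrary: b)
  case 0
  then show ?case by (rule power_series_zero_coeff_0[OF r])
next
  case (Suc n)
  have b0: "b 0 = 0" by (rule power_series_zero_coeff_0[OF r Suc.prems])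
  show ?case
  proof (rule Suc.IH[of "\<lambda>n. b (Suc n)"])
    fix z :: complex assume z: "0 < norm z" "norm z < r"
    have "(\<lambda>n. scale (inverse z) (scale (z ^ n) (b n))) sums 0"
      using sums_scale[OF Suc.prems[OF z], of "inverse z"] by simp
    then have "(\<lambda>N. \<Sum>n<Suc N. scale (inverse z) (scale (z ^ n) (b n))) \<longlonglongrightarrow> 0"
      unfolding sums_def by (rule LIMSEQ_Suc)
    then show "(\<lambda>n. scale (z ^ n) (b (Suc n))) sums 0"
      using z unfolding sums_def sum.lessThan_Suc_shift
      by (simp add: b0 mult.assoc[symmetric])
  qed
qed

lemma power_series_coeffs_unique:
  assumes r: "r > 0"
    and b: "\<And>z. 0 < norm z \<Longrightarrow> norm z < r \<Longrightarrow> (\<lambda>n. scale (z ^ n) (b n)) sums f z"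
    and b': "\<And>z. 0 < norm z \<Longrightarrow> norm z < r \<Longrightarrow> (\<lambda>n. scale (z ^ n) (b' n)) sums f z"
  shows "b n = b' n"
proof -
  have "(\<lambda>n. scale (z ^ n) (b n - b' n)) sums 0" if "0 < norm z" "norm z < r" for z
    using tendsto_diff[OF b[OF that, unfolded sums_def] b'[OF that, unfolded sums_def]]
    unfolding sums_def by (simp add: scale_right_diff_distrib sum_subtractf)
  from power_series_zero_coeffs[OF r this] show ?thesis by simp
qed

section \<open>Termwise differentiation\<close>

text \<open>
  The derivative \<open>D\<close> is assumed to exist and only its value is determined. Let \<open>q(h)\<close> be the difference
  quotient of \<open>f\<close>, and \<open>x(h, n)\<close> that of the \<open>n\<close>-th term, which converges to \<open>T(n)\<close> as \<open>h \<rightarrow> 0\<close>. For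
  \<open>\<bar>z\<bar>, \<bar>z + h\<bar> \<le> \<rho> < r\<close> the term \<open>x(h, n)\<close> is dominated by \<open>g(n) = n \<rho>\<^sup>n\<^sup>-\<^sup>1 p(b(n))\<close>, independently of \<open>h\<close>.
  Hence the distance in \<open>p\<close> of \<open>q(h)\<close> from its \<open>N\<close>-th partial sum is at most the \<open>N\<close>-th tail of \<open>\<Sum> g(n)\<close>,
  and letting \<open>h \<rightarrow> 0\<close> at fixed \<open>N\<close> gives the same bound for the distance of \<open>D\<close> from \<open>\<Sum>n<N. T(n)\<close>.
\<close>

lemma has_cderiv_power_series:
  assumes f: "\<And>z. 0 < norm z \<Longrightarrow> norm z < r \<Longrightarrow> (\<lambda>n. scale (z ^ n) (b n)) sums f z"
    and z: "0 < norm z" "norm z < r" and D: "has_cderiv scale f D z"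
  shows "(\<lambda>n. scale (z ^ n) (scale (of_nat (Suc n)) (b (Suc n)))) sums D"
proof -
  define T where "T = (\<lambda>n. scale (of_nat n * z ^ (n - 1)) (b n))"
  define q where "q = (\<lambda>h. scale (inverse h) (f (z + h) - f z))"
  define x where "x = (\<lambda>h n. scale (inverse h * ((z + h) ^ n - z ^ n)) (b n))"
  obtain \<rho> where \<rho>: "norm z < \<rho>" "\<rho> < r" using z dense[of "norm z" r] by auto
  have near: "\<forall>\<^sub>F h in at 0. h \<noteq> 0 \<and> 0 < norm (z + h) \<and> norm (z + h) < \<rho>"
  proof (intro eventually_conj)
    have "((\<lambda>h. norm (z + h)) \<longlongrightarrow> norm (z + 0)) (at 0)" by (intro tendsto_intros)
    then have lim: "((\<lambda>h. norm (z + h)) \<longlongrightarrow> norm z) (at 0)" by simp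
    show "\<forall>\<^sub>F h in at 0. 0 < norm (z + h)" by (rule order_tendstoD(1)[OF lim z(1)])
    show "\<forall>\<^sub>F h in at 0. norm (z + h) < \<rho>" by (rule order_tendstoD(2)[OF lim \<rho>(1)])
  qed (simp add: eventually_neq_at_within)
  have q_sums: "x h sums q h" if "0 < norm (z + h)" "norm (z + h) < \<rho>" for h
  proof -
    have "(\<lambda>n. scale ((z + h) ^ n) (b n) - scale (z ^ n) (b n)) sums (f (z + h) - f z)"
      using tendsto_diff[OF f[unfolded sums_def, of "z + h"] f[unfolded sums_def, of z]] that z \<rho>
      unfolding sums_def by (simp add: sum_subtractf)
    from sums_scale[OF this, of "inverse h"] show ?thesis
      by (simp add: x_def q_def flip: scale_left_diff_distrib)
  qed
  have "((\<lambda>N. \<Sum>n<N. T n) \<longlongrightarrow> D) sequentially"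
  proof (rule tendsto_if_seminorms_tendsto_0)
    fix p assume p: "continuous_seminorm scale p"
    define g where "g = (\<lambda>n. real n * \<rho> ^ (n - 1) * p (b n))"
    \<comment> \<open>The majorant is the formal derivative of \<open>\<Sum> p(b(n)) x\<^sup>n\<close>, evaluated at \<open>\<rho>\<close>.\<close>
    have "summable (\<lambda>n. diffs (\<lambda>n. p (b n)) n * \<rho> ^ n)"
      using z \<rho> order_le_less_trans[OF norm_ge_zero \<rho>(1)]
      by (intro termdiff_converges[of _ r] summable_seminorm_power_series[OF p f]) auto
    then have "summable (\<lambda>n. g (Suc n))"
      by (simp add: diffs_def g_def mult_ac)
    then have g: "summable g" by (simp only: summable_Suc_iff)
    have x_le: "p (x h n) \<le> g n" if "h \<noteq> 0" "norm (z + h) < \<rho>" for h n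
      using norm_power_difference_quotient_le[of h z \<rho> n] that \<rho> seminorm_nonneg[OF p]
      by (simp add: x_def g_def seminorm_scale[OF p] mult_right_mono)
    have bound: "p (D - (\<Sum>n<N. T n)) \<le> suminf g - (\<Sum>n<N. g n)" for N
    proof (rule tendsto_upperbound)
      show "((\<lambda>h. p (q h - (\<Sum>n<N. x h n))) \<longlongrightarrow> p (D - (\<Sum>n<N. T n))) (at 0)"
        using D unfolding has_cderiv_def x_def T_def q_def
        by (intro seminorm_tendsto[OF p] tendsto_diff tendsto_sum tendsto_scale
            tendsto_power_difference_quotient tendsto_const)
      show "\<forall>\<^sub>F h in at 0. p (q h - (\<Sum>n<N. x h n)) \<le> suminf g - (\<Sum>n<N. g n)"
        using near by eventually_elim (intro seminorm_tail_le[OF p] q_sums x_le g; simp)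
    qed simp
    have lim: "(\<lambda>N. suminf g - (\<Sum>n<N. g n)) \<longlonglongrightarrow> 0"
      using tendsto_diff[OF tendsto_const summable_LIMSEQ[OF g], of "suminf g"] by simp
    have le: "p ((\<Sum>n<N. T n) - D) \<le> suminf g - (\<Sum>n<N. g n)" for N
      using bound[of N] seminorm_minus[OF p, of "(\<Sum>n<N. T n) - D"] by simp
    show "(\<lambda>N. p ((\<Sum>n<N. T n) - D)) \<longlonglongrightarrow> 0"
      by (rule tendsto_sandwich[OF _ _ tendsto_const lim]) (simp_all add: le seminorm_nonneg[OF p])
  qed
  \<comment> \<open>The term \<open>T 0\<close> vanishes, so the index can be shifted by one.\<close>
  then have "(\<lambda>N. \<Sum>n<Suc N. T n) \<longlonglongrightarrow> D" by (rule LIMSEQ_Suc)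
  then show ?thesis
    unfolding sums_def sum.lessThan_Suc_shift by (simp add: T_def mult.commute)
qed

lemma cderiv_eq: "has_cderiv scale f D z \<Longrightarrow> cderiv scale f z = D"
  unfolding cderiv_def has_cderiv_def by (rule the_equality) (auto dest: tendsto_unique[OF at_neq_bot])

definition deriv_coeff :: "(nat \<Rightarrow> 'a) \<Rightarrow> nat \<Rightarrow> nat \<Rightarrow> 'a" where
  "deriv_coeff a j n = scale (of_int (falling_product (int n + int j) j)) (a (n + j))"

lemma deriv_coeff_Suc:
  "deriv_coeff a (Suc j) n = scale (of_nat (Suc n)) (deriv_coeff a j (Suc n))"
proof -
  have "falling_product (int n + int (Suc j)) (Suc j)
      = int (Suc n) * falling_product (int (Suc n) + int j) j"
    by (simp add: falling_product_Suc mult.commute add_ac)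
  then show ?thesis by (simp add: deriv_coeff_def)
qed

lemma higher_cderiv_power_series:
  assumes f: "\<And>z. 0 < norm z \<Longrightarrow> norm z < r \<Longrightarrow> (\<lambda>n. scale (z ^ n) (a n)) sums f z"
    and d: "\<And>z. 0 < norm z \<Longrightarrow> norm z < r \<Longrightarrow> differentiable_up_to scale \<kappa> f z"
    and "j \<le> \<kappa>" "0 < norm z" "norm z < r"
  shows "(\<lambda>n. scale (z ^ n) (deriv_coeff a j n)) sums higher_cderiv scale j f z"
  using assms(3-)
proof (induction j arbitrary: z)
  case 0
  then show ?case using f by (simp add: deriv_coeff_def falling_product_def higher_cderiv_def)
next
  case (Suc j)
  have "j < \<kappa>" using Suc.prems by simp
  then obtain D where D: "has_cderiv scale (higher_cderiv scale j f) D z"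
    using d[OF Suc.prems(2,3)] unfolding differentiable_up_to_def by blast
  have "(\<lambda>n. scale (z ^ n) (scale (of_nat (Suc n)) (deriv_coeff a j (Suc n)))) sums D"
    using Suc.IH Suc.prems by (intro has_cderiv_power_series[OF _ _ _ D, of r]) auto
  moreover have "higher_cderiv scale (Suc j) f z = D"
    using cderiv_eq[OF D] by (simp add: higher_cderiv_def)
  ultimately show ?case by (simp only: deriv_coeff_Suc)
qed

section \<open>Differential operators acting on coefficients\<close>

text \<open>
  Multiplication by \<open>z\<^sup>k\<close> translates the coefficient sequence by \<open>k\<close>; continuation by \<open>0\<close> accounts for
  the first \<open>k\<close> coefficients.
\<close>

lemma sums_shift:
  assumes "(\<lambda>n. scale (z ^ n) (b n)) sums S"
  shows "(\<lambda>m. scale (z ^ m) (extend_by_0 b (int m - int k))) sums scale (z ^ k) S"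
proof (induction k)
  case 0
  then show ?case using assms by (simp add: extend_by_0_def)
next
  case (Suc k)
  have "(\<lambda>m. scale (z ^ Suc m) (extend_by_0 b (int (Suc m) - int (Suc k)))) sums scale (z ^ Suc k) S"
    using sums_scale[OF Suc.IH, of z] by simp
  from sums_Suc[OF this] show ?case by (simp add: extend_by_0_def)
qed

text \<open>
  The formula for the coefficients of the \<open>j\<close>-th derivative persists at negative indices: for
  \<open>-j \<le> m < 0\<close>, where \<open>a(m + j)\<close> need not vanish, the falling product contains the factor \<open>0\<close>.
\<close>

lemma extend_by_0_deriv_coeff:
  "extend_by_0 (deriv_coeff a j) m =
     scale (of_int (falling_product (m + int j) j)) (extend_by_0 a (m + int j))"
proof (cases "0 \<le> m")
  case True
  then show ?thesis by (simp add: extend_by_0_def deriv_coeff_def nat_add_distrib)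
next
  case False
  then show ?thesis
    by (cases "m + int j < 0") (simp_all add: extend_by_0_def falling_product_eq_0)
qed

text \<open>
  This is \<open>\<Omega>\<^sub>L(a)\<close> at an arbitrary integer index. The Laurent series \<open>L \<psi>\<close> also has coefficients at
  negative indices, and the comparison after multiplication by \<open>z\<^sup>M\<close> involves them.
\<close>

definition integer_difference_op ::
  "(int \<Rightarrow> nat \<Rightarrow> 'a) \<Rightarrow> int \<Rightarrow> int \<Rightarrow> nat \<Rightarrow> (nat \<Rightarrow> 'a) \<Rightarrow> int \<Rightarrow> 'a" where
  "integer_difference_op c \<mu> \<nu> \<kappa> a n =
     (\<Sum>i\<in>{\<mu>..\<nu>}. \<Sum>j\<in>{0..\<kappa>}. c i j * extend_by_0 (deriv_coeff a j) (n - i))"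

lemma difference_op_eq_integer_difference_op:
  "difference_op scale c \<mu> \<nu> \<kappa> a n = integer_difference_op c \<mu> \<nu> \<kappa> a (int n)"
  unfolding difference_op_def integer_difference_op_def elementary_difference_op_def
    extend_by_0_deriv_coeff falling_product_def
  by (intro sum.cong refl) (simp add: scale_mult_left scale_mult_right algebra_simps)

text \<open>
  The bound on \<open>M\<close> makes every exponent \<open>M + i\<close> with \<open>i \<ge> \<mu>\<close> nonnegative, so each monomial \<open>z\<^sup>M z\<^sup>i \<partial>\<^sub>z\<^sup>j\<close>
  yields a genuine power series.
\<close>

lemma differential_op_power_series:
  assumes a: "\<And>j. j \<le> \<kappa> \<Longrightarrow>
      (\<lambda>n. scale (z ^ n) (deriv_coeff a j n)) sums higher_cderiv scale j f z"
    and z: "z \<noteq> 0" and M: "0 \<le> int M + \<mu>"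
  shows "(\<lambda>m. scale (z ^ m) (integer_difference_op c \<mu> \<nu> \<kappa> a (int m - int M)))
    sums scale (z ^ M) (differential_op scale c \<mu> \<nu> \<kappa> f z)"
proof -
  have monomial: "(\<lambda>m. scale (z ^ m) (c i j * extend_by_0 (deriv_coeff a j) (int m - int M - i)))
      sums scale (z ^ M) (c i j * monomial_op scale i j f z)"
    if "i \<in> {\<mu>..\<nu>}" "j \<in> {0..\<kappa>}" for i j
  proof -
    define k where "k = nat (int M + i)"
    have k: "int k = int M + i" using M that by (simp add: k_def)
    have "z ^ k = z powi (int M + i)" by (simp flip: k)
    also have "\<dots> = z ^ M * z powi i" using z by (simp add: power_int_add)
    finally have zk: "z ^ k = z ^ M * z powi i" .
    have "(\<lambda>m. scale (z ^ m) (extend_by_0 (deriv_coeff a j) (int m - int k)))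
        sums scale (z ^ k) (higher_cderiv scale j f z)"
      using that by (intro sums_shift a) simp
    from sums_mult_left[OF this, of "c i j"] show ?thesis
      by (simp add: scale_mult_right k zk monomial_op_def algebra_simps)
  qed
  show ?thesis
    unfolding integer_difference_op_def differential_op_def scale_sum_right
    by (intro sums_sum monomial)
qed

text \<open>
  Left and right eigenvalues differ only in the right-hand side \<open>\<phi>\<close> of the equation, which matters only
  through its coefficients \<open>b\<close>.
\<close>

lemma difference_op_eq_coeff:
  assumes an: "analytic_at_0_with_coeffs scale \<psi> a"
    and d: "\<forall>\<^sub>F z in at 0. differentiable_up_to scale \<kappa> \<psi> z"
    and eq: "\<forall>\<^sub>F z in at 0. differential_op scale c \<mu> \<nu> \<kappa> \<psi> z = \<phi> z"
    and \<phi>: "\<And>z. (\<lambda>n. scale (z ^ n) (a n)) sums \<psi> z \<Longrightarrow> (\<lambda>n. scale (z ^ n) (b n)) sums \<phi> z"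
  shows "difference_op scale c \<mu> \<nu> \<kappa> a n = b n"
proof -
  obtain r1 where r1: "r1 > 0" "\<And>z. norm z < r1 \<Longrightarrow> (\<lambda>n. scale (z ^ n) (a n)) sums \<psi> z"
    using an by (auto simp: analytic_at_0_with_coeffs_def)
  obtain r2 where r2: "r2 > 0" "\<And>z. 0 < norm z \<Longrightarrow> norm z < r2 \<Longrightarrow>
      differentiable_up_to scale \<kappa> \<psi> z \<and> differential_op scale c \<mu> \<nu> \<kappa> \<psi> z = \<phi> z"
    using eventually_conj[OF d eq] by (auto simp: eventually_at)
  define r where "r = min r1 r2"
  define M where "M = nat (- \<mu>)"
  have M: "0 \<le> int M + \<mu>" by (simp add: M_def)
  have "integer_difference_op c \<mu> \<nu> \<kappa> a (int m - int M) = extend_by_0 b (int m - int M)" for m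
  proof (rule power_series_coeffs_unique
      [where b = "\<lambda>m. integer_difference_op c \<mu> \<nu> \<kappa> a (int m - int M)"
        and b' = "\<lambda>m. extend_by_0 b (int m - int M)"
        and f = "\<lambda>z. scale (z ^ M) (\<phi> z)"])
    show "r > 0" using r1 r2 by (simp add: r_def)
    fix z :: complex assume z: "0 < norm z" "norm z < r"
    have *: "(\<lambda>n. scale (z ^ n) (a n)) sums \<psi> z"
      using z by (intro r1) (auto simp: r_def)
    show "(\<lambda>m. scale (z ^ m) (extend_by_0 b (int m - int M))) sums scale (z ^ M) (\<phi> z)"
      by (intro sums_shift \<phi> *)
    have "(\<lambda>m. scale (z ^ m) (integer_difference_op c \<mu> \<nu> \<kappa> a (int m - int M)))
        sums scale (z ^ M) (differential_op scale c \<mu> \<nu> \<kappa> \<psi> z)"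
      using z r1 r2
      by (intro differential_op_power_series[OF _ _ M] higher_cderiv_power_series[of r])
        (auto simp: r_def)
    then show "(\<lambda>m. scale (z ^ m) (integer_difference_op c \<mu> \<nu> \<kappa> a (int m - int M)))
        sums scale (z ^ M) (\<phi> z)"
      using r2(2)[of z] z by (simp add: r_def)
  qed
  from this[of "n + M"] show ?thesis
    by (simp add: difference_op_eq_integer_difference_op extend_by_0_def)
qed

end

theorem theorem2p3:
  fixes scale :: "complex \<Rightarrow> 'a::{ring, topological_ab_group_add, t2_space} \<Rightarrow> 'a"
    and R0 :: "'a set"
    and \<psi> :: "complex \<Rightarrow> 'a"
    and a :: "nat \<Rightarrow> 'a"
    and c :: "int \<Rightarrow> nat \<Rightarrow> 'a"
    and \<mu> \<nu> :: int
    and \<kappa> :: nat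
    and lam :: 'a
  assumes "locally_convex_algebra scale"
    and "is_subring R0"
    and "analytic_at_0_with_coeffs scale \<psi> a"
    and "\<mu> < \<nu>"
    and "\<forall>i\<in>{\<mu>..\<nu>}. \<forall>j\<in>{0..\<kappa>}. c i j \<in> R0"
  shows "(left_eigenfunction scale c \<mu> \<nu> \<kappa> \<psi> lam \<longrightarrow>
            left_eigensequence (difference_op scale c \<mu> \<nu> \<kappa>) a lam) \<and>
         (right_eigenfunction scale c \<mu> \<nu> \<kappa> \<psi> lam \<longrightarrow>
            right_eigensequence (difference_op scale c \<mu> \<nu> \<kappa>) a lam)"
proof -
  interpret locally_convex_algebra scale by fact
  have left: "(\<lambda>n. scale (z ^ n) (lam * a n)) sums (lam * \<psi> z)"
    and right: "(\<lambda>n. scale (z ^ n) (a n * lam)) sums (\<psi> z * lam)"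
    if "(\<lambda>n. scale (z ^ n) (a n)) sums \<psi> z" for z
    using sums_mult_left[OF that, of lam] sums_mult_right[OF that, of lam]
    by (simp_all add: scale_mult_left scale_mult_right)
  show ?thesis
    by (auto simp: left_eigenfunction_def right_eigenfunction_def
        left_eigensequence_def right_eigensequence_def
        intro: difference_op_eq_coeff[OF assms(3)] left right)
qed

end
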